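(* Let $R$ be a nontrivial commutative ring with identity such that $|Z(R)^{\star}|>1$. Then: (1) $\mathrm{diam}(\Gamma(R))=1$ if and only if $R\simeq \mathbb{Z}_2^2$ or $Z(R)^2=(0)$. (2) $\mathrm{diam}(\Gamma(R))=2$ if and only if either ($R$ is, up to isomorphism, a subring of a product of two integral domains and $R\not\simeq\mathbb{Z}_2^2$), or ($Z(R)$ is an ideal of $R$, $Z(R)^2\neq(0)$, and for each pair of distinct zero-divisors $x,y$ of $R$, $\mathrm{ann}(x,y)\neq(0)$). (3) $\mathrm{diam}(\Gamma(R))=3$ if and only if one of the following holds: ($R$ is boolean and $R\not\simeq\mathbb{Z}_2^2$); or ($Z(R)$ is not an ideal of $R$ and $R$ is neither boolean nor, up to isomorphism, a subring of a product of two integral domains); or ($Z(R)$ is an ideal of $R$ and there exists a pair of zero-divisors $x,y$ of $R$ such that $\mathrm{ann}(x,y)=(0)$).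
   Context: $Z(R)$ is the set of zero-divisors of $R$ (including $0$) and $Z(R)^{\star}=Z(R)\setminus\{0\}$. $Z(R)^2=(0)$ means $xy=0$ for all $x,y\in Z(R)$. $\mathrm{ann}(x,y)=\{r\in R: rx=ry=0\}$. $\mathbb{Z}_2^2=\mathbb{Z}/2\mathbb{Z}\times\mathbb{Z}/2\mathbb{Z}$. A ring is boolean if every element is idempotent. The zero-divisor graph $\Gamma(R)$ is the undirected simple graph with vertex set $Z(R)^{\star}$ in which distinct $x,y$ are adjacent if and only if $xy=0$. The distance between two vertices is the least length (number of edges) of a path joining them ($\infty$ if there is none), and the diameter $\mathrm{diam}(\Gamma(R))$ is the greatest distance between two vertices. *)

theory Defs
  imports
    "HOL-Algebra.IntRing"
    "HOL-Algebra.Chinese_Remainder"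
    "HOL-Algebra.Subrings"
    "HOL-Library.Extended_Nat"
    "Graph_Theory.Pair_Digraph"
begin

section \<open>Zero-divisors\<close>

definition zero_divisors :: "('a, 'm) ring_scheme \<Rightarrow> 'a set" where
  "zero_divisors R =
    {x \<in> carrier R. \<exists>y \<in> carrier R. y \<noteq> \<zero>\<^bsub>R\<^esub> \<and> x \<otimes>\<^bsub>R\<^esub> y = \<zero>\<^bsub>R\<^esub>}"

definition nonzero_zero_divisors :: "('a, 'm) ring_scheme \<Rightarrow> 'a set" where
  "nonzero_zero_divisors R = zero_divisors R - {\<zero>\<^bsub>R\<^esub>}"

definition zero_divisors_square_zero :: "('a, 'm) ring_scheme \<Rightarrow> bool" where
  "zero_divisors_square_zero R \<longleftrightarrow>
    (\<forall>x \<in> zero_divisors R. \<forall>y \<in> zero_divisors R. x \<otimes>\<^bsub>R\<^esub> y = \<zero>\<^bsub>R\<^esub>)"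

definition ann2 :: "('a, 'm) ring_scheme \<Rightarrow> 'a \<Rightarrow> 'a \<Rightarrow> 'a set" where
  "ann2 R x y =
    {r \<in> carrier R. r \<otimes>\<^bsub>R\<^esub> x = \<zero>\<^bsub>R\<^esub> \<and> r \<otimes>\<^bsub>R\<^esub> y = \<zero>\<^bsub>R\<^esub>}"

definition boolean_ring :: "('a, 'm) ring_scheme \<Rightarrow> bool" where
  "boolean_ring R \<longleftrightarrow> (\<forall>x \<in> carrier R. x \<otimes>\<^bsub>R\<^esub> x = x)"

definition Z2_squared :: "(int set \<times> int set) ring" where
  "Z2_squared = RDirProd (ZFact 2) (ZFact 2)"


section \<open>Subrings of products of two integral domains\<close>

text \<open>
  HOL cannot quantify over the types of the elements of the two domains inside a formula. Taking
  them to be \<open>'a set\<close>, the type of the elements of the quotients of \<open>R\<close>, loses nothing: lemma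
  \<open>subring_of_two_domainsI\<close> below derives the property from an embedding into a product of two
  domains over arbitrary types. Subrings share the identity of the ambient ring.
\<close>

definition subring_of_two_domains :: "('a, 'm) ring_scheme \<Rightarrow> bool" where
  "subring_of_two_domains R \<longleftrightarrow>
    (\<exists>(D\<^sub>1 :: 'a set ring) (D\<^sub>2 :: 'a set ring) S.
       domain D\<^sub>1 \<and> domain D\<^sub>2 \<and> subring S (RDirProd D\<^sub>1 D\<^sub>2) \<and>
       R \<simeq> (RDirProd D\<^sub>1 D\<^sub>2)\<lparr>carrier := S\<rparr>)"

lemma kernel_quotient_domain:
  assumes R: "cring R" and D: "domain D" and h: "h \<in> ring_hom R D"
  shows "domain (R Quot (a_kernel R D h))"
    and "ideal (a_kernel R D h) R"
    and "\<lbrakk>x \<in> carrier R; y \<in> carrier R;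
          a_kernel R D h +>\<^bsub>R\<^esub> x = a_kernel R D h +>\<^bsub>R\<^esub> y\<rbrakk> \<Longrightarrow> h x = h y"
proof -
  interpret R: cring R by (rule R)
  interpret D: domain D by (rule D)
  interpret h: ring_hom_ring R D h
    by (rule ring_hom_ringI2[OF R.ring_axioms D.ring_axioms h])
  have K: "x \<in> a_kernel R D h \<longleftrightarrow> x \<in> carrier R \<and> h x = \<zero>\<^bsub>D\<^esub>" for x
    unfolding a_kernel_def' by (rule mem_Collect_eq)
  show I: "ideal (a_kernel R D h) R"
    by (rule h.kernel_is_ideal)
  have "primeideal (a_kernel R D h) R"
  proof (rule primeidealI[OF I R.is_cring])
    have "\<one>\<^bsub>R\<^esub> \<notin> a_kernel R D h"
      by (simp add: K)
    then show "carrier R \<noteq> a_kernel R D h"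
      using R.one_closed by blast
  next
    fix a b
    assume ab: "a \<in> carrier R" "b \<in> carrier R" "a \<otimes>\<^bsub>R\<^esub> b \<in> a_kernel R D h"
    then have "h a \<otimes>\<^bsub>D\<^esub> h b = \<zero>\<^bsub>D\<^esub>"
      by (simp add: K)
    then show "a \<in> a_kernel R D h \<or> b \<in> a_kernel R D h"
      using ab by (simp add: K D.integral_iff)
  qed
  then show "domain (R Quot (a_kernel R D h))"
    by (rule primeideal.quotient_is_domain)
  show "h x = h y"
    if "x \<in> carrier R" "y \<in> carrier R"
      "a_kernel R D h +>\<^bsub>R\<^esub> x = a_kernel R D h +>\<^bsub>R\<^esub> y" for x y
  proof -
    have "x \<ominus>\<^bsub>R\<^esub> y \<in> a_kernel R D h"
      using R.quotient_eq_iff_same_a_r_cos[OF I] that by blast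
    then have "h (x \<ominus>\<^bsub>R\<^esub> y) = \<zero>\<^bsub>D\<^esub>"
      by (simp add: K)
    then have "h x \<ominus>\<^bsub>D\<^esub> h y = \<zero>\<^bsub>D\<^esub>"
      using that(1,2) by (simp add: a_minus_def)
    then show ?thesis
      using that(1,2) by simp
  qed
qed

lemma subring_of_two_domainsI:
  fixes R :: "('a, 'm) ring_scheme" and D\<^sub>1 :: "('b, 'k) ring_scheme"
    and D\<^sub>2 :: "('c, 'l) ring_scheme"
  assumes R: "cring R" and D: "domain D\<^sub>1" "domain D\<^sub>2"
    and S: "subring S (RDirProd D\<^sub>1 D\<^sub>2)"
    and iso: "R \<simeq> (RDirProd D\<^sub>1 D\<^sub>2)\<lparr>carrier := S\<rparr>"
  shows "subring_of_two_domains R"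
proof -
  interpret R: cring R by (rule R)
  interpret D\<^sub>1: domain D\<^sub>1 by (rule D)
  interpret D\<^sub>2: domain D\<^sub>2 by (rule D)
  interpret P: ring "RDirProd D\<^sub>1 D\<^sub>2"
    by (rule RDirProd_ring) unfold_locales
  obtain f where f: "f \<in> ring_hom R ((RDirProd D\<^sub>1 D\<^sub>2)\<lparr>carrier := S\<rparr>)"
    and inj: "inj_on f (carrier R)"
    using iso unfolding is_ring_iso_def ring_iso_def bij_betw_def by auto
  have "S \<subseteq> carrier D\<^sub>1 \<times> carrier D\<^sub>2"
    using subringE(1)[OF S] by (simp add: RDirProd_carrier)
  then have "fst \<in> ring_hom ((RDirProd D\<^sub>1 D\<^sub>2)\<lparr>carrier := S\<rparr>) D\<^sub>1"
    and "snd \<in> ring_hom ((RDirProd D\<^sub>1 D\<^sub>2)\<lparr>carrier := S\<rparr>) D\<^sub>2"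
    unfolding ring_hom_def RDirProd_def DirProd_def
    by (auto simp: monoid.defs split_beta)
  then have h1: "fst \<circ> f \<in> ring_hom R D\<^sub>1" and h2: "snd \<circ> f \<in> ring_hom R D\<^sub>2"
    using f by (auto intro: ring_hom_trans)
  define I where "I = a_kernel R D\<^sub>1 (fst \<circ> f)"
  define J where "J = a_kernel R D\<^sub>2 (snd \<circ> f)"
  note K1 = kernel_quotient_domain[OF R D(1) h1, folded I_def]
  note K2 = kernel_quotient_domain[OF R D(2) h2, folded J_def]
  let ?Q = "RDirProd (R Quot I) (R Quot J)"
  interpret Q1: domain "R Quot I" by (rule K1(1))
  interpret Q2: domain "R Quot J" by (rule K2(1))
  interpret Q: ring ?Q by (rule RDirProd_ring) unfold_locales
  define g where "g = (\<lambda>r. (I +>\<^bsub>R\<^esub> r, J +>\<^bsub>R\<^esub> r))"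
  have g: "g \<in> ring_hom R ?Q"
    using ring_hom_ring.homh[OF R.canonical_proj_ring_hom[OF K1(2) K2(2)]]
    by (simp add: g_def)
  then interpret g: ring_hom_ring R ?Q g
    by (intro ring_hom_ringI2) unfold_locales
  have "inj_on g (carrier R)"
  proof (rule inj_onI)
    fix x y assume xy: "x \<in> carrier R" "y \<in> carrier R" "g x = g y"
    then have "fst (f x) = fst (f y)" "snd (f x) = snd (f y)"
      using K1(3)[of x y] K2(3)[of x y] by (auto simp: g_def)
    then show "x = y"
      using xy by (intro inj_onD[OF inj]) (auto simp only: prod_eq_iff)
  qed
  then have "g \<in> ring_iso R (?Q\<lparr>carrier := g ` carrier R\<rparr>)"
    using g by (auto simp: ring_iso_def ring_hom_def bij_betw_def)
  moreover have "subring (g ` carrier R) ?Q"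
    by (rule g.img_is_subring[OF R.carrier_is_subring])
  ultimately show ?thesis
    using K1(1) K2(1) unfolding subring_of_two_domains_def is_ring_iso_def
    by (intro exI[of _ "R Quot I"] exI[of _ "R Quot J"] exI[of _ "g ` carrier R"]) blast
qed


section \<open>Distance and diameter\<close>

text \<open>
  Undirected simple graphs are the loop-free symmetric digraphs without parallel arcs, possibly
  infinite; these are the instances of \<^locale>\<open>pair_bidirected_digraph\<close>. The infimum of the
  empty set of extended naturals is \<open>\<infinity>\<close>.
\<close>

definition graph_distance :: "('v, 'e) pre_digraph \<Rightarrow> 'v \<Rightarrow> 'v \<Rightarrow> enat" where
  "graph_distance G u v = (INF p \<in> {p. pre_digraph.apath G u p v}. enat (length p))"

definition graph_diameter :: "('v, 'e) pre_digraph \<Rightarrow> enat" where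
  "graph_diameter G = (SUP u \<in> verts G. SUP v \<in> verts G. graph_distance G u v)"

definition zero_divisor_graph :: "('a, 'm) ring_scheme \<Rightarrow> 'a pair_pre_digraph" where
  "zero_divisor_graph R =
    \<lparr>pverts = nonzero_zero_divisors R,
     parcs = {(x, y). x \<in> nonzero_zero_divisors R \<and> y \<in> nonzero_zero_divisors R \<and>
                      x \<noteq> y \<and> x \<otimes>\<^bsub>R\<^esub> y = \<zero>\<^bsub>R\<^esub>}\<rparr>"

lemma zero_divisor_graph_bidirected:
  assumes "cring R"
  shows "pair_bidirected_digraph (zero_divisor_graph R)"
proof -
  interpret cring R by (rule assms)
  have "x \<in> carrier R" if "x \<in> nonzero_zero_divisors R" for x
    using that by (simp add: nonzero_zero_divisors_def zero_divisors_def)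
  then have "sym (parcs (zero_divisor_graph R))"
    by (intro symI) (auto simp: zero_divisor_graph_def m_comm)
  then show ?thesis
    by unfold_locales (auto simp: zero_divisor_graph_def symmetric_def)
qed

end

theory Submission
  imports Defs
begin

text \<open>
  Two distinct vertices \<open>x\<close>, \<open>y\<close> of \<open>\<Gamma>(R)\<close> are adjacent iff \<open>xy = 0\<close>, and they are at distance at
  most 2 iff \<open>xy = 0\<close> or \<open>ann(x, y) \<noteq> 0\<close>, because for \<open>xy \<noteq> 0\<close> the common neighbours are exactly the
  nonzero elements of \<open>ann(x, y)\<close>. If neither holds, choose nonzero \<open>a\<close>, \<open>b\<close> with \<open>ax = by = 0\<close>; the product \<open>ab\<close> lies in
  \<open>ann(x, y) = 0\<close>, so \<open>x - a - b - y\<close> is a path. Hence the diameter never exceeds 3, and all three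
  parts of the theorem follow from algebraic descriptions of "at most 1" (\<open>pairwise_annihilating\<close>)
  and "at most 2" (\<open>pairwise_linked\<close>).

  Diameter at most 1. Suppose distinct zero-divisors annihilate each other. If all of them square to
  zero, then \<open>Z(R)\<^sup>2 = 0\<close>. Otherwise take a zero-divisor \<open>x\<close> with \<open>x\<^sup>2 \<noteq> 0\<close>. Comparing \<open>x\<close> with \<open>x\<^sup>2\<close>,
  with \<open>x + x\<^sup>2\<close> and with its other multiples shows that \<open>x\<close> is idempotent and \<open>Rx = {0, x}\<close>. The
  complementary idempotent \<open>1 - x\<close> satisfies the same hypotheses, so \<open>R\<close> is the product of two
  rings with two elements (\<open>pairwise_annihilating_iff\<close>).

  Diameter at most 2, when \<open>Z(R)\<close> is an ideal. Suppose \<open>ann(x, y) = 0\<close> for zero-divisors \<open>x\<close>, \<open>y\<close>. If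
  the diameter were at most 2, then \<open>xy = 0\<close>; as \<open>x + y\<close> is also a zero-divisor and
  \<open>ann(x, x + y) = 0\<close>, also \<open>x\<^sup>2 = x(x + y) = 0\<close>. Then \<open>x\<close> itself lies in \<open>ann(x, y)\<close>, which is
  absurd (\<open>pairwise_linked_iff_if_ideal\<close>).

  Diameter at most 2, when \<open>Z(R)\<close> is not an ideal. Then some sum \<open>a + b\<close> of zero-divisors is regular,
  so \<open>ann(a) \<inter> ann(b) = ann(a, b) = 0\<close>. The key point is that \<open>ann(a)\<close> and \<open>ann(b)\<close> are prime
  (\<open>primeideal_annihilator_if_linked\<close>): if \<open>cda = 0\<close> with \<open>ca\<close> and \<open>da\<close> nonzero, then \<open>a\<close> and \<open>b + ca\<close>
  are at distance 3. Thus \<open>R\<close> embeds into \<open>R/ann(a) \<times> R/ann(b)\<close>. The converse is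
  read off in terms of two prime ideals with zero intersection, which is what being a subring of a
  product of two domains amounts to (\<open>subring_of_two_domains_iff_primeideals\<close>): every zero-divisor
  lies in one of the two primes, elements of different primes have product zero, and
  two nonzero zero-divisors in the same prime are killed by a common nonzero element of the other.

  It remains to separate the cases. A subring of a product of two domains is reduced, and
  its zero-divisors do not form an ideal as soon as nonzero ones exist; if it is also boolean, its
  graph is complete and it is therefore \<open>\<int>\<^sub>2\<^sup>2\<close>. In a boolean ring with a
  nonzero zero-divisor \<open>x\<close>, the sum \<open>x + (1 - x) = 1\<close> of two zero-divisors is regular, so \<open>Z(R)\<close> is
  not an ideal there either.
\<close>

section \<open>Zero-divisors and common annihilators\<close>

text \<open>
  Completeness of the zero-divisor graph, that is, diameter at most 1.
\<close>

definition pairwise_annihilating :: "('a, 'm) ring_scheme \<Rightarrow> bool" where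
  "pairwise_annihilating R \<longleftrightarrow>
    (\<forall>x \<in> nonzero_zero_divisors R. \<forall>y \<in> nonzero_zero_divisors R.
       x \<noteq> y \<longrightarrow> x \<otimes>\<^bsub>R\<^esub> y = \<zero>\<^bsub>R\<^esub>)"

text \<open>
  Diameter at most 2: the condition on \<open>ann(x, y)\<close> expresses, for vertices with \<open>xy \<noteq> 0\<close>, that they
  have a common neighbour.
\<close>

definition pairwise_linked :: "('a, 'm) ring_scheme \<Rightarrow> bool" where
  "pairwise_linked R \<longleftrightarrow>
    (\<forall>x \<in> nonzero_zero_divisors R. \<forall>y \<in> nonzero_zero_divisors R.
       x \<noteq> y \<longrightarrow> x \<otimes>\<^bsub>R\<^esub> y = \<zero>\<^bsub>R\<^esub> \<or> ann2 R x y \<noteq> {\<zero>\<^bsub>R\<^esub>})"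

context cring
begin

lemma zero_divisorsI:
  "\<lbrakk>x \<in> carrier R; c \<in> carrier R; c \<noteq> \<zero>; c \<otimes> x = \<zero>\<rbrakk> \<Longrightarrow> x \<in> zero_divisors R"
  by (auto simp: zero_divisors_def m_comm)

lemma zero_divisorsE:
  assumes "x \<in> zero_divisors R"
  obtains c where "x \<in> carrier R" "c \<in> carrier R" "c \<noteq> \<zero>" "c \<otimes> x = \<zero>"
  using assms by (auto simp: zero_divisors_def m_comm)

lemma zero_divisors_closed: "x \<in> zero_divisors R \<Longrightarrow> x \<in> carrier R"
  by (simp add: zero_divisors_def)

lemma nonzero_zero_divisors_iff: "x \<in> nonzero_zero_divisors R \<longleftrightarrow> x \<in> zero_divisors R \<and> x \<noteq> \<zero>"
  by (simp add: nonzero_zero_divisors_def)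

lemma one_notin_zero_divisors: "\<one> \<notin> zero_divisors R"
  by (auto elim: zero_divisorsE)

lemma mult_zero_divisor:
  assumes "r \<in> carrier R" "x \<in> zero_divisors R"
  shows "r \<otimes> x \<in> zero_divisors R"
proof -
  obtain c where c: "x \<in> carrier R" "c \<in> carrier R" "c \<noteq> \<zero>" "c \<otimes> x = \<zero>"
    using assms(2) by (rule zero_divisorsE)
  then have "c \<otimes> (r \<otimes> x) = \<zero>"
    using assms(1) by (simp add: m_lcomm[of c r x])
  then show ?thesis
    using assms(1) c by (blast intro: zero_divisorsI)
qed

lemma ann2_trivialD:
  "\<lbrakk>ann2 R x y = {\<zero>}; c \<in> carrier R; c \<otimes> x = \<zero>; c \<otimes> y = \<zero>\<rbrakk> \<Longrightarrow> c = \<zero>"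
  by (auto simp: ann2_def)

lemma ann2_trivialI:
  assumes "x \<in> carrier R" "y \<in> carrier R"
    and "\<And>c. \<lbrakk>c \<in> carrier R; c \<otimes> x = \<zero>; c \<otimes> y = \<zero>\<rbrakk> \<Longrightarrow> c = \<zero>"
  shows "ann2 R x y = {\<zero>}"
  using assms by (auto simp: ann2_def)

lemma ann2_self_nontrivial: "x \<in> zero_divisors R \<Longrightarrow> ann2 R x x \<noteq> {\<zero>}"
  by (blast elim: zero_divisorsE dest: ann2_trivialD)

lemma ann2_zero_nontrivial:
  assumes "x \<in> zero_divisors R"
  shows "ann2 R x \<zero> \<noteq> {\<zero>}" and "ann2 R \<zero> x \<noteq> {\<zero>}"
proof -
  obtain c where c: "x \<in> carrier R" "c \<in> carrier R" "c \<noteq> \<zero>" "c \<otimes> x = \<zero>"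
    using assms by (rule zero_divisorsE)
  then have "c \<in> ann2 R x \<zero>" "c \<in> ann2 R \<zero> x"
    by (simp_all add: ann2_def)
  with c(3) show "ann2 R x \<zero> \<noteq> {\<zero>}" "ann2 R \<zero> x \<noteq> {\<zero>}"
    by blast+
qed

text \<open>
  A zero-divisor shares a nonzero annihilator with \<open>0\<close> and with itself, so \<open>ann(x, y) = 0\<close> already
  makes \<open>x\<close> and \<open>y\<close> two distinct vertices.
\<close>

lemma pairwise_linkedD:
  assumes "pairwise_linked R" "x \<in> zero_divisors R" "y \<in> zero_divisors R"
    and ann: "ann2 R x y = {\<zero>}"
  shows "x \<otimes> y = \<zero>"
proof -
  have "x \<noteq> \<zero>" "y \<noteq> \<zero>" "x \<noteq> y"
    using assms ann2_zero_nontrivial ann2_self_nontrivial by metis+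
  then show ?thesis
    using assms unfolding pairwise_linked_def nonzero_zero_divisors_iff Ball_def by blast
qed

lemma ann2_trivial_if_regular_sum:
  assumes "x \<in> carrier R" "y \<in> carrier R" "x \<oplus> y \<notin> zero_divisors R"
  shows "ann2 R x y = {\<zero>}"
proof (rule ann2_trivialI[OF assms(1,2)])
  fix c assume c: "c \<in> carrier R" "c \<otimes> x = \<zero>" "c \<otimes> y = \<zero>"
  then have "c \<otimes> (x \<oplus> y) = \<zero>"
    using assms(1,2) by (simp add: r_distr)
  then show "c = \<zero>"
    using assms c(1) zero_divisorsI by blast
qed

lemma ideal_zero_divisors_iff:
  assumes "\<one> \<noteq> \<zero>"
  shows "ideal (zero_divisors R) R \<longleftrightarrow>
    (\<forall>x \<in> zero_divisors R. \<forall>y \<in> zero_divisors R. x \<oplus> y \<in> zero_divisors R)"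
proof
  assume "ideal (zero_divisors R) R"
  then show "\<forall>x \<in> zero_divisors R. \<forall>y \<in> zero_divisors R. x \<oplus> y \<in> zero_divisors R"
    by (blast intro: additive_subgroup.a_closed ideal.axioms)
next
  assume sum: "\<forall>x \<in> zero_divisors R. \<forall>y \<in> zero_divisors R. x \<oplus> y \<in> zero_divisors R"
  have "\<zero> \<in> zero_divisors R"
    using assms by (intro zero_divisorsI[of _ \<one>]) auto
  moreover have "\<ominus> x \<in> zero_divisors R" if "x \<in> zero_divisors R" for x
    using mult_zero_divisor[of "\<ominus> \<one>" x] zero_divisors_closed[OF that] that
    by (simp add: l_minus)
  ultimately have "subgroup (zero_divisors R) (add_monoid R)"
    using sum zero_divisors_closed by (intro add.subgroupI) auto
  then show "ideal (zero_divisors R) R"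
  proof (rule idealI[OF ring_axioms])
    fix a x assume ax: "a \<in> zero_divisors R" "x \<in> carrier R"
    then show "x \<otimes> a \<in> zero_divisors R"
      by (simp add: mult_zero_divisor)
    with ax show "a \<otimes> x \<in> zero_divisors R"
      by (simp add: m_comm zero_divisors_closed)
  qed
qed

section \<open>Diameter at most two\<close>

text \<open>
  If \<open>ann(x, y) = 0\<close>, then being linked forces \<open>xy = 0\<close>. The pair \<open>x\<close>, \<open>x + y\<close> generates the same
  ideal, so it has the same annihilator; it consists of zero-divisors because these form an ideal, and
  being linked now forces \<open>x\<^sup>2 = 0\<close>. So \<open>x\<close> lies in
  \<open>ann(x, y)\<close>; it is nonzero because \<open>ann(0, y) = ann(y) \<noteq> 0\<close>.
\<close>

lemma pairwise_linked_iff_if_ideal: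
  assumes I: "ideal (zero_divisors R) R"
  shows "pairwise_linked R \<longleftrightarrow>
    (\<forall>x \<in> zero_divisors R. \<forall>y \<in> zero_divisors R. ann2 R x y \<noteq> {\<zero>})"
proof
  assume linked: "pairwise_linked R"
  interpret Z: ideal "zero_divisors R" R by (rule I)
  have sq: "x \<otimes> x = \<zero>"
    if x: "x \<in> zero_divisors R" and y: "y \<in> zero_divisors R"
      and ann: "ann2 R x y = {\<zero>}" for x y
  proof -
    have [simp]: "x \<in> carrier R" "y \<in> carrier R"
      using x y by (auto intro: zero_divisors_closed)
    have "ann2 R x (x \<oplus> y) = {\<zero>}"
      using ann by (intro ann2_trivialI) (auto simp: r_distr dest: ann2_trivialD)
    then have "x \<otimes> (x \<oplus> y) = \<zero>"
      using linked x y by (intro pairwise_linkedD) auto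
    moreover have "x \<otimes> y = \<zero>"
      using linked x y ann by (rule pairwise_linkedD)
    ultimately show ?thesis
      by (simp add: r_distr)
  qed
  show "\<forall>x \<in> zero_divisors R. \<forall>y \<in> zero_divisors R. ann2 R x y \<noteq> {\<zero>}"
  proof (intro ballI notI)
    fix x y assume xy: "x \<in> zero_divisors R" "y \<in> zero_divisors R" "ann2 R x y = {\<zero>}"
    then have "x \<otimes> x = \<zero>" "x \<otimes> y = \<zero>"
      using sq linked pairwise_linkedD by blast+
    then have "x = \<zero>"
      using xy by (auto intro: ann2_trivialD zero_divisors_closed)
    then show False
      using xy ann2_zero_nontrivial by blast
  qed
next
  assume "\<forall>x \<in> zero_divisors R. \<forall>y \<in> zero_divisors R. ann2 R x y \<noteq> {\<zero>}"
  then show "pairwise_linked R"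
    by (simp add: pairwise_linked_def nonzero_zero_divisors_iff)
qed

lemma ideal_annihilator:
  assumes [simp]: "a \<in> carrier R"
  shows "ideal {r \<in> carrier R. r \<otimes> a = \<zero>} R"
proof (rule idealI[OF ring_axioms])
  show "subgroup {r \<in> carrier R. r \<otimes> a = \<zero>} (add_monoid R)"
    by (rule add.subgroupI) (auto simp: l_distr l_minus intro: exI[of _ \<zero>])
next
  fix r x assume rx: "r \<in> {r \<in> carrier R. r \<otimes> a = \<zero>}" "x \<in> carrier R"
  then have "(x \<otimes> r) \<otimes> a = \<zero>"
    by (simp add: m_assoc)
  with rx show "x \<otimes> r \<in> {r \<in> carrier R. r \<otimes> a = \<zero>}"
      and "r \<otimes> x \<in> {r \<in> carrier R. r \<otimes> a = \<zero>}"
    by (simp_all add: m_comm[of r x])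
qed

text \<open>
  For \<open>ca \<noteq> 0\<close>, \<open>da \<noteq> 0\<close> and \<open>cda = 0\<close> the element \<open>x = ca + b\<close> is a zero-divisor killed by \<open>da\<close>
  (note \<open>ab = 0\<close>). Modulo \<open>a\<close> it agrees with \<open>b\<close>, so \<open>ann(a, x) = ann(a, b) = 0\<close> and being linked
  gives \<open>0 = ax = ca\<^sup>2\<close>. Then \<open>ca\<close> kills both \<open>a\<close> and \<open>b\<close>, which contradicts \<open>ca \<noteq> 0\<close>.
\<close>

lemma primeideal_annihilator_if_linked:
  assumes linked: "pairwise_linked R"
    and a: "a \<in> zero_divisors R" and b: "b \<in> zero_divisors R"
    and reg: "a \<oplus> b \<notin> zero_divisors R"
  shows "primeideal {r \<in> carrier R. r \<otimes> a = \<zero>} R"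
proof -
  have [simp]: "a \<in> carrier R" "b \<in> carrier R"
    using a b by (auto intro: zero_divisors_closed)
  have ann: "ann2 R a b = {\<zero>}"
    using reg by (intro ann2_trivial_if_regular_sum) auto
  have ab: "a \<otimes> b = \<zero>"
    using linked a b ann by (rule pairwise_linkedD)
  have cancel: "r = \<zero>" if "r \<in> carrier R" "r \<otimes> a = \<zero>" "r \<otimes> b = \<zero>" for r
    using ann that by (rule ann2_trivialD)
  show ?thesis
  proof (rule primeidealI[OF ideal_annihilator is_cring])
    have "a \<noteq> \<zero>"
      using ann b ann2_zero_nontrivial by blast
    then show "carrier R \<noteq> {r \<in> carrier R. r \<otimes> a = \<zero>}"
      using l_one[of a] one_closed by force
  next
    fix c d
    assume cd: "c \<in> carrier R" "d \<in> carrier R" "c \<otimes> d \<in> {r \<in> carrier R. r \<otimes> a = \<zero>}"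
    show "c \<in> {r \<in> carrier R. r \<otimes> a = \<zero>} \<or> d \<in> {r \<in> carrier R. r \<otimes> a = \<zero>}"
    proof (rule ccontr)
      assume "\<not> ?thesis"
      then have ca: "c \<otimes> a \<noteq> \<zero>" and da: "d \<otimes> a \<noteq> \<zero>"
        using cd by auto
      define x where "x = c \<otimes> a \<oplus> b"
      have x [simp]: "x \<in> carrier R"
        using cd by (simp add: x_def)
      have "(d \<otimes> a) \<otimes> x = a \<otimes> ((c \<otimes> d) \<otimes> a) \<oplus> d \<otimes> (a \<otimes> b)"
        unfolding x_def using cd(1,2) \<open>a \<in> carrier R\<close> \<open>b \<in> carrier R\<close> by algebra
      then have "(d \<otimes> a) \<otimes> x = \<zero>"
        using cd ab by simp
      then have xZ: "x \<in> zero_divisors R"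
        using da cd by (intro zero_divisorsI[of _ "d \<otimes> a"]) auto
      have "ann2 R a x = {\<zero>}"
      proof (rule ann2_trivialI)
        fix r assume r: "r \<in> carrier R" "r \<otimes> a = \<zero>" "r \<otimes> x = \<zero>"
        have "r \<otimes> x = c \<otimes> (r \<otimes> a) \<oplus> r \<otimes> b"
          unfolding x_def using r(1) cd(1,2) \<open>a \<in> carrier R\<close> \<open>b \<in> carrier R\<close> by algebra
        then have "r \<otimes> b = \<zero>"
          using r cd by simp
        then show "r = \<zero>"
          using r cancel by blast
      qed auto
      then have "a \<otimes> x = \<zero>"
        using linked a xZ by (intro pairwise_linkedD)
      moreover have "a \<otimes> x = (c \<otimes> a) \<otimes> a \<oplus> a \<otimes> b"
        unfolding x_def using cd(1,2) \<open>a \<in> carrier R\<close> \<open>b \<in> carrier R\<close> by algebra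
      ultimately have "(c \<otimes> a) \<otimes> a = \<zero>"
        using ab cd by simp
      moreover have "(c \<otimes> a) \<otimes> b = \<zero>"
        using ab cd by (simp add: m_assoc)
      ultimately show False
        using ca cd cancel[of "c \<otimes> a"] by simp
    qed
  qed simp
qed

end

lemma primeideal_kernel:
  assumes R: "cring R" and D: "domain D" and h: "h \<in> ring_hom R D"
  shows "primeideal (a_kernel R D h) R"
  using cring.quot_domain_imp_primeideal[OF R kernel_quotient_domain(2)[OF assms]
    kernel_quotient_domain(1)[OF assms]] .

text \<open>
  The two prime ideals are the kernels of the projections to the two domains. This form stays inside
  \<open>R\<close>, so later arguments need no embedding.
\<close>

lemma subring_of_two_domains_iff_primeideals:
  fixes R :: "('a, 'm) ring_scheme"
  assumes R: "cring R"
  shows "subring_of_two_domains R \<longleftrightarrow>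
    (\<exists>I J. primeideal I R \<and> primeideal J R \<and> I \<inter> J = {\<zero>\<^bsub>R\<^esub>})"
proof
  interpret R: cring R by (rule R)
  assume "subring_of_two_domains R"
  then obtain D1 D2 :: "'a set ring" and S
    where D: "domain D1" "domain D2" and S: "subring S (RDirProd D1 D2)"
      and iso: "R \<simeq> (RDirProd D1 D2)\<lparr>carrier := S\<rparr>"
    unfolding subring_of_two_domains_def by (elim exE conjE)
  from iso obtain f where f: "f \<in> ring_hom R ((RDirProd D1 D2)\<lparr>carrier := S\<rparr>)"
    and inj: "inj_on f (carrier R)"
    unfolding is_ring_iso_def ring_iso_def bij_betw_def by auto
  interpret D1: domain D1 by (rule D)
  interpret D2: domain D2 by (rule D)
  interpret P: ring "RDirProd D1 D2" by (rule RDirProd_ring) unfold_locales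
  interpret f: ring_hom_ring R "(RDirProd D1 D2)\<lparr>carrier := S\<rparr>" f
    using f by (intro ring_hom_ringI2 R.ring_axioms P.subring_is_ring[OF S])
  have "S \<subseteq> carrier D1 \<times> carrier D2"
    using subringE(1)[OF S] by (simp add: RDirProd_carrier)
  then have "fst \<in> ring_hom ((RDirProd D1 D2)\<lparr>carrier := S\<rparr>) D1"
    and "snd \<in> ring_hom ((RDirProd D1 D2)\<lparr>carrier := S\<rparr>) D2"
    unfolding ring_hom_def RDirProd_def DirProd_def
    by (auto simp: monoid.defs split_beta)
  then have h: "fst \<circ> f \<in> ring_hom R D1" "snd \<circ> f \<in> ring_hom R D2"
    using f by (auto intro: ring_hom_trans)
  have z: "\<zero>\<^bsub>RDirProd D1 D2\<^esub> = (\<zero>\<^bsub>D1\<^esub>, \<zero>\<^bsub>D2\<^esub>)"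
    by (simp add: RDirProd_def monoid.defs)
  have f0: "f \<zero>\<^bsub>R\<^esub> = (\<zero>\<^bsub>D1\<^esub>, \<zero>\<^bsub>D2\<^esub>)"
    using f.hom_zero by (simp add: z)
  have joint: "r = \<zero>\<^bsub>R\<^esub>" if "r \<in> carrier R" "fst (f r) = \<zero>\<^bsub>D1\<^esub>" "snd (f r) = \<zero>\<^bsub>D2\<^esub>" for r
  proof (rule inj_onD[OF inj])
    show "f r = f \<zero>\<^bsub>R\<^esub>"
      using that by (simp only: f0 prod_eq_iff fst_conv snd_conv)
  qed (use that in auto)
  have ker: "x \<in> a_kernel R D h \<longleftrightarrow> x \<in> carrier R \<and> h x = \<zero>\<^bsub>D\<^esub>"
    for x h and D :: "'a set ring"
    unfolding a_kernel_def' by (rule mem_Collect_eq)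
  have "a_kernel R D1 (fst \<circ> f) \<inter> a_kernel R D2 (snd \<circ> f) = {\<zero>\<^bsub>R\<^esub>}"
  proof (intro equalityI subsetI)
    fix r assume "r \<in> a_kernel R D1 (fst \<circ> f) \<inter> a_kernel R D2 (snd \<circ> f)"
    then have "r \<in> carrier R" "fst (f r) = \<zero>\<^bsub>D1\<^esub>" "snd (f r) = \<zero>\<^bsub>D2\<^esub>"
      by (simp_all only: Int_iff ker o_apply)
    then show "r \<in> {\<zero>\<^bsub>R\<^esub>}"
      using joint by blast
  next
    fix r assume "r \<in> {\<zero>\<^bsub>R\<^esub>}"
    then show "r \<in> a_kernel R D1 (fst \<circ> f) \<inter> a_kernel R D2 (snd \<circ> f)"
      by (simp only: Int_iff ker o_apply singleton_iff f0 fst_conv snd_conv R.zero_closed simp_thms)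
  qed
  then show "\<exists>I J. primeideal I R \<and> primeideal J R \<and> I \<inter> J = {\<zero>\<^bsub>R\<^esub>}"
    using primeideal_kernel[OF R D(1) h(1)] primeideal_kernel[OF R D(2) h(2)] by blast
next
  interpret R: cring R by (rule R)
  assume "\<exists>I J. primeideal I R \<and> primeideal J R \<and> I \<inter> J = {\<zero>\<^bsub>R\<^esub>}"
  then obtain I J where I: "primeideal I R" and J: "primeideal J R"
    and IJ: "I \<inter> J = {\<zero>\<^bsub>R\<^esub>}" by blast
  interpret I: primeideal I R by (rule I)
  interpret J: primeideal J R by (rule J)
  let ?Q = "RDirProd (R Quot I) (R Quot J)"
  define g where "g = (\<lambda>r. (I +>\<^bsub>R\<^esub> r, J +>\<^bsub>R\<^esub> r))"
  interpret g: ring_hom_ring R ?Q g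
    unfolding g_def by (rule R.canonical_proj_ring_hom[OF I.is_ideal J.is_ideal])
  have "inj_on g (carrier R)"
  proof (rule inj_onI)
    fix x y assume xy: "x \<in> carrier R" "y \<in> carrier R" "g x = g y"
    then have "x \<ominus>\<^bsub>R\<^esub> y \<in> I \<inter> J"
      using R.quotient_eq_iff_same_a_r_cos[OF I.is_ideal] R.quotient_eq_iff_same_a_r_cos[OF J.is_ideal]
      by (auto simp: g_def)
    then show "x = y"
      using xy IJ by simp
  qed
  then have "g \<in> ring_iso R (?Q\<lparr>carrier := g ` carrier R\<rparr>)"
    using g.homh by (auto simp: ring_iso_def ring_hom_def bij_betw_def)
  moreover have "subring (g ` carrier R) ?Q"
    by (rule g.img_is_subring[OF R.carrier_is_subring])
  ultimately show "subring_of_two_domains R"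
    using I.quotient_is_domain J.quotient_is_domain
    unfolding subring_of_two_domains_def is_ring_iso_def
    by (intro exI[of _ "R Quot I"] exI[of _ "R Quot J"] exI[of _ "g ` carrier R"]) blast
qed

lemma (in cring) zero_divisors_if_two_primeideals:
  assumes "primeideal I R" "primeideal J R" "I \<inter> J = {\<zero>}" "x \<in> zero_divisors R"
  shows "x \<in> I \<or> x \<in> J"
proof -
  interpret I: primeideal I R by fact
  interpret J: primeideal J R by fact
  obtain c where c: "x \<in> carrier R" "c \<in> carrier R" "c \<noteq> \<zero>" "c \<otimes> x = \<zero>"
    using assms(4) by (rule zero_divisorsE)
  moreover have "c \<in> I \<or> x \<in> I" "c \<in> J \<or> x \<in> J"
    using c I.I_prime[of c x] J.I_prime[of c x] by auto
  ultimately show ?thesis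
    using assms(3) by blast
qed

lemma (in cring) mult_eq_zero_if_trivial_Int:
  assumes "ideal I R" "ideal J R" "I \<inter> J = {\<zero>}" "x \<in> I" "y \<in> J"
  shows "x \<otimes> y = \<zero>"
proof -
  interpret I: ideal I R by fact
  interpret J: ideal J R by fact
  have "x \<otimes> y \<in> I" "x \<otimes> y \<in> J"
    using assms(4,5) by (simp_all add: I.I_r_closed J.I_l_closed)
  then show ?thesis
    using assms(3) by blast
qed

context cring
begin

text \<open>
  A nonzero \<open>x \<in> I\<close> lies outside \<open>J\<close>, so \<open>cx = 0 \<in> J\<close> forces \<open>c \<in> J\<close>.
\<close>

lemma annihilator_in_other_primeideal:
  assumes "primeideal J R" "I \<inter> J = {\<zero>}"
    and x: "x \<in> nonzero_zero_divisors R" "x \<in> I"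
  obtains c where "c \<in> J" "c \<noteq> \<zero>" "c \<otimes> x = \<zero>" "x \<notin> J"
proof -
  interpret J: primeideal J R by fact
  have "x \<notin> J"
    using assms by (auto simp: nonzero_zero_divisors_iff)
  obtain c where c: "x \<in> carrier R" "c \<in> carrier R" "c \<noteq> \<zero>" "c \<otimes> x = \<zero>"
    using x(1) by (auto simp: nonzero_zero_divisors_iff elim: zero_divisorsE)
  then have "c \<in> J"
    using J.I_prime[of c x] \<open>x \<notin> J\<close> by auto
  then show thesis
    using that c \<open>x \<notin> J\<close> by blast
qed

text \<open>
  A nonzero annihilator of \<open>x\<close> in \<open>J\<close> kills all of \<open>I\<close>, as \<open>IJ = 0\<close>.
\<close>

lemma ann2_nontrivial_in_primeideal:
  assumes I: "ideal I R" and J: "primeideal J R" and IJ: "I \<inter> J = {\<zero>}"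
    and x: "x \<in> nonzero_zero_divisors R" "x \<in> I" and y: "y \<in> I"
  shows "ann2 R x y \<noteq> {\<zero>}"
proof -
  obtain c where c: "c \<in> J" "c \<noteq> \<zero>" "c \<otimes> x = \<zero>"
    using annihilator_in_other_primeideal[OF J IJ x] by blast
  have J': "ideal J R"
    using J by (rule primeideal.axioms)
  have yc: "y \<in> carrier R" "c \<in> carrier R"
    using y c(1) ideal.Icarr[OF I] ideal.Icarr[OF J'] by auto
  have "y \<otimes> c = \<zero>"
    using I J' IJ y c(1) by (rule mult_eq_zero_if_trivial_Int)
  then have "c \<in> ann2 R x y"
    using c yc by (simp add: ann2_def m_comm)
  then show ?thesis
    using c(2) by blast
qed

lemma pairwise_linked_if_primeideals:
  assumes I: "primeideal I R" and J: "primeideal J R" and IJ: "I \<inter> J = {\<zero>}"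
  shows "pairwise_linked R"
  unfolding pairwise_linked_def
proof (intro ballI impI)
  fix x y
  assume x: "x \<in> nonzero_zero_divisors R" and y: "y \<in> nonzero_zero_divisors R"
  have I': "ideal I R" and J': "ideal J R"
    using I J by (auto intro: primeideal.axioms)
  have JI: "J \<inter> I = {\<zero>}"
    using IJ by blast
  have "x \<in> I \<or> x \<in> J" "y \<in> I \<or> y \<in> J"
    using x y zero_divisors_if_two_primeideals[OF I J IJ]
    by (auto simp: nonzero_zero_divisors_iff)
  then consider "x \<in> I" "y \<in> I" | "x \<in> J" "y \<in> J" | "x \<in> I" "y \<in> J" | "x \<in> J" "y \<in> I"
    by blast
  then show "x \<otimes> y = \<zero> \<or> ann2 R x y \<noteq> {\<zero>}"
  proof cases
    case 1
    then show ?thesis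
      using ann2_nontrivial_in_primeideal[OF I' J IJ x] by blast
  next
    case 2
    then show ?thesis
      using ann2_nontrivial_in_primeideal[OF J' I JI x] by blast
  next
    case 3
    then show ?thesis
      using mult_eq_zero_if_trivial_Int[OF I' J' IJ] by blast
  next
    case 4
    then show ?thesis
      using mult_eq_zero_if_trivial_Int[OF J' I' JI] by blast
  qed
qed

lemma reduced_if_primeideals:
  assumes "primeideal I R" "primeideal J R" and IJ: "I \<inter> J = {\<zero>}"
    and x: "x \<in> carrier R" "x \<otimes> x = \<zero>"
  shows "x = \<zero>"
proof -
  interpret I: primeideal I R by fact
  interpret J: primeideal J R by fact
  show ?thesis
    using x IJ I.I_prime[of x x] J.I_prime[of x x] by auto
qed

text \<open>
  For a nonzero zero-divisor \<open>x \<in> I\<close> and a nonzero annihilator \<open>c \<in> J\<close> of it, the sum \<open>x + c\<close> lies in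
  neither of the primes, so it is regular.
\<close>

lemma not_ideal_zero_divisors_if_primeideals:
  assumes I: "primeideal I R" and J: "primeideal J R" and IJ: "I \<inter> J = {\<zero>}"
    and ne: "nonzero_zero_divisors R \<noteq> {}"
  shows "\<not> ideal (zero_divisors R) R"
proof
  assume "ideal (zero_divisors R) R"
  then interpret Z: ideal "zero_divisors R" R .
  have contra: False
    if I: "primeideal I R" and J: "primeideal J R" and IJ: "I \<inter> J = {\<zero>}"
      and x: "x \<in> nonzero_zero_divisors R" "x \<in> I" for I J x
  proof -
    interpret I: primeideal I R by (rule I)
    interpret J: primeideal J R by (rule J)
    obtain c where c: "c \<in> J" "c \<noteq> \<zero>" "c \<otimes> x = \<zero>" "x \<notin> J"
      using annihilator_in_other_primeideal[OF J IJ x] by blast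
    have [simp]: "x \<in> carrier R" "c \<in> carrier R"
      using x(2) c(1) by auto
    have "x \<otimes> c = \<zero>" "x \<noteq> \<zero>" "x \<in> zero_divisors R"
      using c(3) x(1) by (auto simp: m_comm nonzero_zero_divisors_iff)
    then have "x \<oplus> c \<in> zero_divisors R"
      by (intro Z.a_closed zero_divisorsI[of c x]) auto
    then consider "x \<oplus> c \<in> I" | "x \<oplus> c \<in> J"
      using zero_divisors_if_two_primeideals[OF I J IJ] by blast
    then show False
    proof cases
      case 1
      have "\<ominus> x \<oplus> (x \<oplus> c) \<in> I"
        by (intro I.a_closed I.a_inv_closed 1 x)
      moreover have "\<ominus> x \<oplus> (x \<oplus> c) = c"
        by (simp add: r_neg1)
      ultimately show False
        using c IJ by auto
    next
      case 2
      have "(x \<oplus> c) \<oplus> \<ominus> c \<in> J"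
        by (intro J.a_closed J.a_inv_closed 2 c)
      moreover have "(x \<oplus> c) \<oplus> \<ominus> c = x"
        by (simp add: a_assoc r_neg)
      ultimately show False
        using c by simp
    qed
  qed
  obtain x where x: "x \<in> nonzero_zero_divisors R"
    using ne by blast
  then have "x \<in> I \<or> x \<in> J"
    using zero_divisors_if_two_primeideals[OF I J IJ] by (simp add: nonzero_zero_divisors_iff)
  then show False
    using contra[OF I J IJ x] contra[OF J I _ x] IJ by (auto simp: Int_commute)
qed

text \<open>
  Modulo the prime ideal \<open>J\<close> the only idempotents are \<open>0\<close> and \<open>1\<close>. Two elements of \<open>I\<close> outside \<open>J\<close> are
  therefore both \<open>1\<close> modulo \<open>J\<close>, and since \<open>I \<inter> J = 0\<close> they are equal. In the calculation this appears as
  \<open>xy(x - y) = 0\<close>.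
\<close>

lemma pairwise_annihilating_if_boolean_primeideals:
  assumes bool: "boolean_ring R"
    and I: "primeideal I R" and J: "primeideal J R" and IJ: "I \<inter> J = {\<zero>}"
  shows "pairwise_annihilating R"
  unfolding pairwise_annihilating_def
proof (intro ballI impI)
  fix x y
  assume x: "x \<in> nonzero_zero_divisors R" and y: "y \<in> nonzero_zero_divisors R" and "x \<noteq> y"
  have [simp]: "x \<in> carrier R" "y \<in> carrier R"
    using x y by (auto simp: nonzero_zero_divisors_iff zero_divisors_closed)
  have same: "x = y"
    if I: "primeideal I R" and J: "primeideal J R" and IJ: "I \<inter> J = {\<zero>}"
      and xy: "x \<in> I" "y \<in> I" for I J
  proof -
    interpret I: primeideal I R by (rule I)
    interpret J: primeideal J R by (rule J)
    have notin: "x \<notin> J" "y \<notin> J"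
      using xy x y IJ by (auto simp: nonzero_zero_divisors_iff)
    have "(x \<otimes> y) \<otimes> (x \<ominus> y) = (x \<otimes> x) \<otimes> y \<ominus> x \<otimes> (y \<otimes> y)"
      using \<open>x \<in> carrier R\<close> \<open>y \<in> carrier R\<close> by algebra
    also have "\<dots> = \<zero>"
      using bool by (simp add: boolean_ring_def a_minus_def r_neg)
    finally have "x \<ominus> y \<in> J"
      using notin J.I_prime[of "x \<otimes> y" "x \<ominus> y"] J.I_prime[of x y] by auto
    moreover have "x \<ominus> y \<in> I"
      unfolding a_minus_def by (intro I.a_closed I.a_inv_closed xy)
    ultimately have "x \<ominus> y = \<zero>"
      using IJ by blast
    then show ?thesis
      by simp
  qed
  have I': "ideal I R" and J': "ideal J R"
    using I J by (auto intro: primeideal.axioms)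
  have JI: "J \<inter> I = {\<zero>}"
    using IJ by blast
  have "x \<in> I \<or> x \<in> J" "y \<in> I \<or> y \<in> J"
    using x y zero_divisors_if_two_primeideals[OF I J IJ]
    by (auto simp: nonzero_zero_divisors_iff)
  then show "x \<otimes> y = \<zero>"
    using same[OF I J IJ] same[OF J I JI] \<open>x \<noteq> y\<close>
      mult_eq_zero_if_trivial_Int[OF I' J' IJ] mult_eq_zero_if_trivial_Int[OF J' I' JI] by blast
qed

text \<open>
  Two zero-divisors \<open>a\<close>, \<open>b\<close> with regular sum provide the two prime ideals \<open>ann(a)\<close> and \<open>ann(b)\<close>.
\<close>

lemma pairwise_linked_iff_if_not_ideal:
  assumes "\<one> \<noteq> \<zero>" and nideal: "\<not> ideal (zero_divisors R) R"
  shows "pairwise_linked R \<longleftrightarrow> subring_of_two_domains R"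
proof
  assume linked: "pairwise_linked R"
  obtain a b where a: "a \<in> zero_divisors R" and b: "b \<in> zero_divisors R"
    and reg: "a \<oplus> b \<notin> zero_divisors R"
    using assms ideal_zero_divisors_iff by blast
  have reg': "b \<oplus> a \<notin> zero_divisors R"
    using reg a b by (simp add: a_comm zero_divisors_closed)
  have "{r \<in> carrier R. r \<otimes> a = \<zero>} \<inter> {r \<in> carrier R. r \<otimes> b = \<zero>} = ann2 R a b"
    by (auto simp: ann2_def)
  also have "\<dots> = {\<zero>}"
    using a b reg by (intro ann2_trivial_if_regular_sum zero_divisors_closed)
  finally show "subring_of_two_domains R"
    using primeideal_annihilator_if_linked[OF linked a b reg]
      primeideal_annihilator_if_linked[OF linked b a reg']
      subring_of_two_domains_iff_primeideals[OF is_cring] by blast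
next
  assume "subring_of_two_domains R"
  then show "pairwise_linked R"
    using subring_of_two_domains_iff_primeideals[OF is_cring] pairwise_linked_if_primeideals by blast
qed

section \<open>Diameter at most one\<close>

text \<open>
  If \<open>x\<^sup>2 \<noteq> x\<close>, then \<open>x\<close> annihilates the other vertex \<open>x\<^sup>2\<close>, so \<open>x\<^sup>3 = 0\<close>. Now
  \<open>y = x + x\<^sup>2\<close> is a zero-divisor different from \<open>x\<close>, but \<open>xy = x\<^sup>2 \<noteq> 0\<close>. Once \<open>x\<close> is idempotent,
  it fixes its multiples, so a multiple other than \<open>0\<close> and \<open>x\<close> would not be annihilated by \<open>x\<close>.
\<close>

lemma idempotent_if_pairwise_annihilating:
  assumes ann: "pairwise_annihilating R" and x: "x \<in> zero_divisors R" and sq: "x \<otimes> x \<noteq> \<zero>"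
  shows "x \<otimes> x = x" and "r \<in> carrier R \<Longrightarrow> r \<otimes> x \<in> {\<zero>, x}"
proof -
  have [simp]: "x \<in> carrier R"
    using x by (rule zero_divisors_closed)
  have annD: "x \<otimes> y = \<zero>" if "y \<in> zero_divisors R" "y \<noteq> \<zero>" "y \<noteq> x" for y
  proof -
    have "x \<noteq> \<zero>"
      using sq by auto
    then show ?thesis
      using ann x that unfolding pairwise_annihilating_def nonzero_zero_divisors_iff Ball_def by metis
  qed
  show idem: "x \<otimes> x = x"
  proof (rule ccontr)
    assume "x \<otimes> x \<noteq> x"
    then have cube: "x \<otimes> (x \<otimes> x) = \<zero>"
      using x sq by (intro annD mult_zero_divisor) auto
    define y where "y = (\<one> \<oplus> x) \<otimes> x"
    have y: "y = x \<oplus> x \<otimes> x"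
      by (simp add: y_def l_distr)
    then have xy: "x \<otimes> y = x \<otimes> x"
      by (simp add: r_distr cube)
    have "y \<noteq> \<zero>"
      using xy sq by auto
    moreover have "y \<noteq> x"
      using y sq by simp
    moreover have "y \<in> zero_divisors R"
      unfolding y_def using x by (intro mult_zero_divisor) auto
    ultimately show False
      using annD[of y] xy sq by simp
  qed
  show "r \<otimes> x \<in> {\<zero>, x}" if r: "r \<in> carrier R"
  proof (rule ccontr)
    assume *: "r \<otimes> x \<notin> {\<zero>, x}"
    then have "x \<otimes> (r \<otimes> x) = \<zero>"
      using r x by (intro annD mult_zero_divisor) auto
    moreover have "x \<otimes> (r \<otimes> x) = r \<otimes> x"
      using r idem by (simp add: m_lcomm[of x r x])
    ultimately show False
      using * by simp
  qed
qed

end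

text \<open>
  The elements \<open>e\<close> and \<open>f\<close> are complementary idempotents (multiply \<open>e + f = 1\<close> by either one) that
  split \<open>R\<close> into two factors with two elements each: \<open>R = Re \<times> Rf\<close> with \<open>Re = {0, e}\<close> and
  \<open>Rf = {0, f}\<close>. A pair of elements describes \<open>\<int>\<^sub>2\<^sup>2\<close> up to isomorphism without leaving \<open>R\<close>.
\<close>

definition binary_splitting :: "('a, 'm) ring_scheme \<Rightarrow> 'a \<Rightarrow> 'a \<Rightarrow> bool" where
  "binary_splitting R e f \<longleftrightarrow>
    e \<in> carrier R \<and> f \<in> carrier R \<and> e \<noteq> \<zero>\<^bsub>R\<^esub> \<and> f \<noteq> \<zero>\<^bsub>R\<^esub> \<and>
    e \<oplus>\<^bsub>R\<^esub> f = \<one>\<^bsub>R\<^esub> \<and> e \<otimes>\<^bsub>R\<^esub> f = \<zero>\<^bsub>R\<^esub> \<and>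
    (\<forall>r \<in> carrier R. r \<otimes>\<^bsub>R\<^esub> e \<in> {\<zero>\<^bsub>R\<^esub>, e} \<and> r \<otimes>\<^bsub>R\<^esub> f \<in> {\<zero>\<^bsub>R\<^esub>, f})"

lemma ZFact_2:
  shows "carrier (ZFact 2) = {\<zero>\<^bsub>ZFact 2\<^esub>, \<one>\<^bsub>ZFact 2\<^esub>}"
    and "\<one>\<^bsub>ZFact 2\<^esub> \<oplus>\<^bsub>ZFact 2\<^esub> \<one>\<^bsub>ZFact 2\<^esub> = \<zero>\<^bsub>ZFact 2\<^esub>"
proof -
  interpret F: domain "ZFact 2"
    by (rule ZFact_prime_is_domain) simp
  interpret I: ideal "Idl\<^bsub>\<Z>\<^esub> {2::int}" \<Z>
    by (rule int.genideal_ideal) simp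
  have hom: "ring_hom_ring \<Z> (ZFact 2) (\<lambda>k. ZMod 2 k)"
    unfolding ZFact_def ZMod_def by (rule I.rcos_ring_hom_ring)
  interpret h: ring_hom_ring \<Z> "ZFact 2" "\<lambda>k. ZMod 2 k"
    by (rule hom)
  have 0: "ZMod 2 0 = \<zero>\<^bsub>ZFact 2\<^esub>"
    using h.hom_zero by simp
  have 1: "ZMod 2 1 = \<one>\<^bsub>ZFact 2\<^esub>"
    using h.hom_one by simp
  have "k mod 2 = 0 \<or> k mod 2 = 1" for k :: int
    by presburger
  then have "ZMod 2 k \<in> {\<zero>\<^bsub>ZFact 2\<^esub>, \<one>\<^bsub>ZFact 2\<^esub>}" for k
    using ZMod_mod[of 2 k] 0 1 by (metis insert_iff)
  moreover have "carrier (ZFact 2) = range (ZMod 2)"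
    by (auto simp: ZFact_defs A_RCOSETS_def' ZMod_def)
  ultimately have "carrier (ZFact 2) \<subseteq> {\<zero>\<^bsub>ZFact 2\<^esub>, \<one>\<^bsub>ZFact 2\<^esub>}"
    by (simp only: image_subset_iff ball_simps simp_thms)
  then show "carrier (ZFact 2) = {\<zero>\<^bsub>ZFact 2\<^esub>, \<one>\<^bsub>ZFact 2\<^esub>}"
    by (simp add: subset_antisym)
  have "\<one>\<^bsub>ZFact 2\<^esub> \<oplus>\<^bsub>ZFact 2\<^esub> \<one>\<^bsub>ZFact 2\<^esub> = ZMod 2 2"
    using h.hom_add[of 1 1] unfolding 1 by simp
  also have "\<dots> = ZMod 2 0"
    by (rule zmod_imp_ZMod) simp
  also note 0
  finally show "\<one>\<^bsub>ZFact 2\<^esub> \<oplus>\<^bsub>ZFact 2\<^esub> \<one>\<^bsub>ZFact 2\<^esub> = \<zero>\<^bsub>ZFact 2\<^esub>" .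
qed

lemma Z2_squared_simps:
  "carrier Z2_squared = carrier (ZFact 2) \<times> carrier (ZFact 2)"
  "\<zero>\<^bsub>Z2_squared\<^esub> = (\<zero>\<^bsub>ZFact 2\<^esub>, \<zero>\<^bsub>ZFact 2\<^esub>)"
  "\<one>\<^bsub>Z2_squared\<^esub> = (\<one>\<^bsub>ZFact 2\<^esub>, \<one>\<^bsub>ZFact 2\<^esub>)"
  "(a, b) \<oplus>\<^bsub>Z2_squared\<^esub> (c, d) = (a \<oplus>\<^bsub>ZFact 2\<^esub> c, b \<oplus>\<^bsub>ZFact 2\<^esub> d)"
  "(a, b) \<otimes>\<^bsub>Z2_squared\<^esub> (c, d) = (a \<otimes>\<^bsub>ZFact 2\<^esub> c, b \<otimes>\<^bsub>ZFact 2\<^esub> d)"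
  by (simp_all add: Z2_squared_def RDirProd_def DirProd_def monoid.defs)

lemma binary_splitting_Z2_squared:
  "binary_splitting Z2_squared (\<one>\<^bsub>ZFact 2\<^esub>, \<zero>\<^bsub>ZFact 2\<^esub>) (\<zero>\<^bsub>ZFact 2\<^esub>, \<one>\<^bsub>ZFact 2\<^esub>)"
proof -
  interpret F: domain "ZFact 2"
    by (rule ZFact_prime_is_domain) simp
  show ?thesis
    using ZFact_2(1) by (auto simp: binary_splitting_def Z2_squared_simps)
qed

lemma (in ring_hom_ring) binary_splitting_image:
  assumes split: "binary_splitting R e f" and inj: "inj_on h (carrier R)"
    and surj: "h ` carrier R = carrier S"
  shows "binary_splitting S (h e) (h f)"
proof -
  have ef: "e \<in> carrier R" "f \<in> carrier R" "e \<noteq> \<zero>\<^bsub>R\<^esub>" "f \<noteq> \<zero>\<^bsub>R\<^esub>"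
    "e \<oplus>\<^bsub>R\<^esub> f = \<one>\<^bsub>R\<^esub>" "e \<otimes>\<^bsub>R\<^esub> f = \<zero>\<^bsub>R\<^esub>"
    and mult: "r \<in> carrier R \<Longrightarrow> r \<otimes>\<^bsub>R\<^esub> e \<in> {\<zero>\<^bsub>R\<^esub>, e}"
      "r \<in> carrier R \<Longrightarrow> r \<otimes>\<^bsub>R\<^esub> f \<in> {\<zero>\<^bsub>R\<^esub>, f}" for r
    using split by (auto simp: binary_splitting_def)
  have "h x \<noteq> \<zero>\<^bsub>S\<^esub>" if x: "x \<in> carrier R" "x \<noteq> \<zero>\<^bsub>R\<^esub>" for x
  proof
    assume "h x = \<zero>\<^bsub>S\<^esub>"
    then have "h x = h \<zero>\<^bsub>R\<^esub>"
      by (simp only: hom_zero)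
    then show False
      using inj_onD[OF inj] x R.zero_closed by blast
  qed
  then have "h e \<noteq> \<zero>\<^bsub>S\<^esub>" "h f \<noteq> \<zero>\<^bsub>S\<^esub>"
    using ef by blast+
  moreover have "h e \<oplus>\<^bsub>S\<^esub> h f = \<one>\<^bsub>S\<^esub>" "h e \<otimes>\<^bsub>S\<^esub> h f = \<zero>\<^bsub>S\<^esub>"
    using ef hom_add[of e f] hom_mult[of e f] by simp_all
  moreover have "s \<otimes>\<^bsub>S\<^esub> h e \<in> {\<zero>\<^bsub>S\<^esub>, h e} \<and> s \<otimes>\<^bsub>S\<^esub> h f \<in> {\<zero>\<^bsub>S\<^esub>, h f}"
    if s: "s \<in> carrier S" for s
  proof -
    obtain r where r: "r \<in> carrier R" "s = h r"
      using s unfolding surj[symmetric] by (rule imageE)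
    then have "s \<otimes>\<^bsub>S\<^esub> h e = h (r \<otimes>\<^bsub>R\<^esub> e)" "s \<otimes>\<^bsub>S\<^esub> h f = h (r \<otimes>\<^bsub>R\<^esub> f)"
      using ef by simp_all
    then show ?thesis
      using mult[OF r(1)] hom_zero by auto
  qed
  ultimately show ?thesis
    using ef by (simp add: binary_splitting_def)
qed

context cring
begin

text \<open>
  This is multiplication by \<open>e\<close>, followed by the identification of \<open>Re = {0, e}\<close> with \<open>\<int>\<^sub>2\<close>. It is
  additive because \<open>2e = 0\<close>: as \<open>2e\<close> is a multiple of \<open>e\<close>, it is \<open>0\<close> or \<open>e\<close>, and \<open>2e = e\<close> would give
  \<open>e = 0\<close>.
\<close>

lemma ring_hom_ZFact_2:
  assumes e: "e \<in> carrier R" "e \<noteq> \<zero>" and mult: "\<And>r. r \<in> carrier R \<Longrightarrow> r \<otimes> e \<in> {\<zero>, e}"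
  shows "(\<lambda>r. if r \<otimes> e = \<zero> then \<zero>\<^bsub>ZFact 2\<^esub> else \<one>\<^bsub>ZFact 2\<^esub>) \<in> ring_hom R (ZFact 2)"
proof (rule ring_hom_memI)
  interpret F: domain "ZFact 2"
    by (rule ZFact_prime_is_domain) simp
  fix r s assume r: "r \<in> carrier R" and s: "s \<in> carrier R"
  have "(\<one> \<oplus> \<one>) \<otimes> e \<in> {\<zero>, e}"
    using mult by blast
  then have ee: "e \<oplus> e = \<zero>"
    using e by (auto simp: l_distr)
  have add: "(r \<oplus> s) \<otimes> e = r \<otimes> e \<oplus> s \<otimes> e"
    using r s e by (simp add: l_distr)
  have mul: "(r \<otimes> s) \<otimes> e = r \<otimes> (s \<otimes> e)"
    using r s e by (simp add: m_assoc)
  show "(if (r \<otimes> s) \<otimes> e = \<zero> then \<zero>\<^bsub>ZFact 2\<^esub> else \<one>\<^bsub>ZFact 2\<^esub>) =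
      (if r \<otimes> e = \<zero> then \<zero>\<^bsub>ZFact 2\<^esub> else \<one>\<^bsub>ZFact 2\<^esub>) \<otimes>\<^bsub>ZFact 2\<^esub>
      (if s \<otimes> e = \<zero> then \<zero>\<^bsub>ZFact 2\<^esub> else \<one>\<^bsub>ZFact 2\<^esub>)"
    unfolding mul using mult[OF r] mult[OF s] e(2) r by auto
  show "(if (r \<oplus> s) \<otimes> e = \<zero> then \<zero>\<^bsub>ZFact 2\<^esub> else \<one>\<^bsub>ZFact 2\<^esub>) =
      (if r \<otimes> e = \<zero> then \<zero>\<^bsub>ZFact 2\<^esub> else \<one>\<^bsub>ZFact 2\<^esub>) \<oplus>\<^bsub>ZFact 2\<^esub>
      (if s \<otimes> e = \<zero> then \<zero>\<^bsub>ZFact 2\<^esub> else \<one>\<^bsub>ZFact 2\<^esub>)"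
    unfolding add using mult[OF r] mult[OF s] e ee ZFact_2(2) by auto
qed (use e ZFact_2(1) in auto)

lemma iso_Z2_squared_if_binary_splitting:
  assumes split: "binary_splitting R e f"
  shows "R \<simeq> Z2_squared"
proof -
  interpret F: domain "ZFact 2"
    by (rule ZFact_prime_is_domain) simp
  have ef [simp]: "e \<in> carrier R" "f \<in> carrier R" "e \<noteq> \<zero>" "f \<noteq> \<zero>"
    "e \<otimes> f = \<zero>" "f \<otimes> e = \<zero>" and sum: "e \<oplus> f = \<one>"
    and mult: "r \<in> carrier R \<Longrightarrow> r \<otimes> e \<in> {\<zero>, e}" "r \<in> carrier R \<Longrightarrow> r \<otimes> f \<in> {\<zero>, f}" for r
    using split by (auto simp: binary_splitting_def m_comm)
  define \<chi> where "\<chi> a r = (if r \<otimes> a = \<zero> then \<zero>\<^bsub>ZFact 2\<^esub> else \<one>\<^bsub>ZFact 2\<^esub>)" for a r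
  define g where "g r = (\<chi> e r, \<chi> f r)" for r
  have "\<chi> e \<in> ring_hom R (ZFact 2)" "\<chi> f \<in> ring_hom R (ZFact 2)"
    unfolding \<chi>_def using mult by (intro ring_hom_ZFact_2; simp)+
  then have g: "g \<in> ring_hom R Z2_squared"
    by (simp add: ring_hom_def Z2_squared_simps g_def Pi_iff)
  have idem: "e \<otimes> e = e" "f \<otimes> f = f"
    using r_distr[of e f e] r_distr[of e f f] sum by simp_all
  have "inj_on g (carrier R)"
  proof (rule inj_onI)
    fix r s assume rs: "r \<in> carrier R" "s \<in> carrier R" "g r = g s"
    then have "r \<otimes> e = s \<otimes> e" "r \<otimes> f = s \<otimes> f"
      using mult[of r] mult[of s] by (auto simp: g_def \<chi>_def split: if_splits)
    then have "r \<otimes> (e \<oplus> f) = s \<otimes> (e \<oplus> f)"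
      using rs by (simp add: r_distr)
    then show "r = s"
      using rs by (simp add: sum)
  qed
  moreover have "g ` carrier R = carrier Z2_squared"
  proof
    show "g ` carrier R \<subseteq> carrier Z2_squared"
      using g by (auto simp: ring_hom_def)
    have vals: "g \<zero> = (\<zero>\<^bsub>ZFact 2\<^esub>, \<zero>\<^bsub>ZFact 2\<^esub>)" "g \<one> = (\<one>\<^bsub>ZFact 2\<^esub>, \<one>\<^bsub>ZFact 2\<^esub>)"
      "g e = (\<one>\<^bsub>ZFact 2\<^esub>, \<zero>\<^bsub>ZFact 2\<^esub>)" "g f = (\<zero>\<^bsub>ZFact 2\<^esub>, \<one>\<^bsub>ZFact 2\<^esub>)"
      by (simp_all add: g_def \<chi>_def idem)
    have "carrier Z2_squared \<subseteq> {g \<zero>, g \<one>, g e, g f}"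
      unfolding vals Z2_squared_simps ZFact_2(1) by blast
    also have "\<dots> \<subseteq> g ` carrier R"
      by simp
    finally show "carrier Z2_squared \<subseteq> g ` carrier R" .
  qed
  ultimately show ?thesis
    using g by (auto simp: is_ring_iso_def ring_iso_def bij_betw_def)
qed

lemma iso_Z2_squared_iff: "R \<simeq> Z2_squared \<longleftrightarrow> (\<exists>e f. binary_splitting R e f)"
proof
  assume "R \<simeq> Z2_squared"
  then have "Z2_squared \<simeq> R"
    by (rule ring_iso_sym[OF ring_axioms])
  then obtain h where h: "h \<in> ring_hom Z2_squared R"
    and bij: "inj_on h (carrier Z2_squared)" "h ` carrier Z2_squared = carrier R"
    by (auto simp: is_ring_iso_def ring_iso_def bij_betw_def)
  have "ring Z2_squared"
    unfolding Z2_squared_def by (intro RDirProd_ring cring.axioms ZFact_is_cring)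
  then interpret h: ring_hom_ring Z2_squared R h
    using h by (intro ring_hom_ringI2 ring_axioms)
  show "\<exists>e f. binary_splitting R e f"
    using h.binary_splitting_image[OF binary_splitting_Z2_squared bij] by blast
next
  assume "\<exists>e f. binary_splitting R e f"
  then show "R \<simeq> Z2_squared"
    using iso_Z2_squared_if_binary_splitting by blast
qed

lemma nonzero_zero_divisors_binary_splitting:
  assumes split: "binary_splitting R e f"
  shows "nonzero_zero_divisors R = {e, f}"
proof -
  have ef [simp]: "e \<in> carrier R" "f \<in> carrier R" "e \<noteq> \<zero>" "f \<noteq> \<zero>"
    "e \<otimes> f = \<zero>" "f \<otimes> e = \<zero>" and sum: "e \<oplus> f = \<one>"
    and mult: "r \<in> carrier R \<Longrightarrow> r \<otimes> e \<in> {\<zero>, e}" "r \<in> carrier R \<Longrightarrow> r \<otimes> f \<in> {\<zero>, f}" for r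
    using split by (auto simp: binary_splitting_def m_comm)
  have "e \<in> zero_divisors R" "f \<in> zero_divisors R"
    using zero_divisorsI[of e f] zero_divisorsI[of f e] by simp_all
  moreover have "x \<in> {\<zero>, \<one>, e, f}" if x: "x \<in> carrier R" for x
  proof -
    have "x = x \<otimes> e \<oplus> x \<otimes> f"
      using x sum r_distr[of e f x] by simp
    then show ?thesis
      using mult[OF x] sum by auto
  qed
  ultimately show ?thesis
    using one_notin_zero_divisors zero_divisors_closed ef
    unfolding nonzero_zero_divisors_def by blast
qed

lemma pairwise_annihilating_if_iso_Z2_squared:
  assumes "R \<simeq> Z2_squared"
  shows "pairwise_annihilating R"
proof -
  obtain e f where split: "binary_splitting R e f"
    using assms iso_Z2_squared_iff by blast
  then have "e \<otimes> f = \<zero>" "f \<otimes> e = \<zero>"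
    by (auto simp: binary_splitting_def m_comm)
  then show ?thesis
    by (auto simp: pairwise_annihilating_def nonzero_zero_divisors_binary_splitting[OF split])
qed

lemma not_ideal_zero_divisors_if_iso_Z2_squared:
  assumes "R \<simeq> Z2_squared"
  shows "\<not> ideal (zero_divisors R) R"
proof
  assume "ideal (zero_divisors R) R"
  then interpret Z: ideal "zero_divisors R" R .
  obtain e f where split: "binary_splitting R e f"
    using assms iso_Z2_squared_iff by blast
  then have "e \<in> zero_divisors R" "f \<in> zero_divisors R" "e \<oplus> f = \<one>"
    using nonzero_zero_divisors_binary_splitting[OF split]
    by (auto simp: binary_splitting_def nonzero_zero_divisors_def)
  then have "\<one> \<in> zero_divisors R"
    using Z.a_closed by metis
  then show False
    using one_notin_zero_divisors by blast
qed

text \<open>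
  The element \<open>1 - x\<close> is a nonzero idempotent, killed by \<open>x\<close>, so what holds for \<open>x\<close> holds for it too.
\<close>

lemma binary_splitting_if_pairwise_annihilating:
  assumes ann: "pairwise_annihilating R" and x: "x \<in> zero_divisors R" and sq: "x \<otimes> x \<noteq> \<zero>"
  shows "binary_splitting R x (\<one> \<ominus> x)"
proof -
  define f where "f = \<one> \<ominus> x"
  have [simp]: "x \<in> carrier R" "f \<in> carrier R" "x \<noteq> \<zero>"
    using zero_divisors_closed[OF x] sq by (auto simp: f_def)
  have idem: "x \<otimes> x = x"
    using ann x sq by (rule idempotent_if_pairwise_annihilating)
  have "x \<noteq> \<one>"
    using x one_notin_zero_divisors by blast
  then have f0: "f \<noteq> \<zero>"
    by (simp add: f_def)
  have sum: "x \<oplus> f = \<one>"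
    unfolding f_def using \<open>x \<in> carrier R\<close> by algebra
  have "x \<otimes> f = x \<ominus> x \<otimes> x"
    unfolding f_def using \<open>x \<in> carrier R\<close> by algebra
  then have xf: "x \<otimes> f = \<zero>"
    by (simp add: idem a_minus_def r_neg)
  then have fZ: "f \<in> zero_divisors R"
    by (intro zero_divisorsI[of f x]) auto
  have "f \<otimes> (x \<oplus> f) = f \<otimes> f"
    using xf by (simp add: r_distr m_comm[of f x])
  then have "f \<otimes> f \<noteq> \<zero>"
    using f0 by (simp add: sum)
  then show ?thesis
    using idempotent_if_pairwise_annihilating(2)[OF ann x sq]
      idempotent_if_pairwise_annihilating(2)[OF ann fZ] f0 sum xf
    unfolding binary_splitting_def f_def[symmetric] by simp
qed

lemma pairwise_annihilating_iff:
  "pairwise_annihilating R \<longleftrightarrow> R \<simeq> Z2_squared \<or> zero_divisors_square_zero R"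
proof
  assume ann: "pairwise_annihilating R"
  show "R \<simeq> Z2_squared \<or> zero_divisors_square_zero R"
  proof (cases "\<forall>x \<in> zero_divisors R. x \<otimes> x = \<zero>")
    case True
    have "x \<otimes> y = \<zero>" if "x \<in> zero_divisors R" "y \<in> zero_divisors R" for x y
    proof (cases "x = y \<or> x = \<zero> \<or> y = \<zero>")
      case True
      then show ?thesis
        using that \<open>\<forall>x \<in> zero_divisors R. x \<otimes> x = \<zero>\<close> by (auto simp: zero_divisors_closed)
    next
      case False
      then show ?thesis
        using that ann by (auto simp: pairwise_annihilating_def nonzero_zero_divisors_def)
    qed
    then show ?thesis
      by (simp add: zero_divisors_square_zero_def)
  next
    case False
    then show ?thesis
      using binary_splitting_if_pairwise_annihilating[OF ann] iso_Z2_squared_iff by blast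
  qed
next
  assume "R \<simeq> Z2_squared \<or> zero_divisors_square_zero R"
  then show "pairwise_annihilating R"
    using pairwise_annihilating_if_iso_Z2_squared
    by (auto simp: pairwise_annihilating_def zero_divisors_square_zero_def nonzero_zero_divisors_def)
qed

end

section \<open>Distances in the zero-divisor graph\<close>

text \<open>
  A set of extended naturals attains its infimum when it is nonempty, so a finite bound on the
  distance is witnessed by a path.
\<close>

lemma graph_distance_le_iff:
  "graph_distance G u v \<le> enat n \<longleftrightarrow> (\<exists>p. pre_digraph.apath G u p v \<and> length p \<le> n)"
proof
  assume le: "graph_distance G u v \<le> enat n"
  show "\<exists>p. pre_digraph.apath G u p v \<and> length p \<le> n"
  proof (rule ccontr)
    assume "\<not> ?thesis"
    then have "enat (Suc n) \<le> graph_distance G u v"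
      unfolding graph_distance_def by (intro INF_greatest) (auto simp: not_le Suc_le_eq)
    then have "enat (Suc n) \<le> enat n"
      using le by (rule order_trans)
    then show False
      by simp
  qed
next
  assume "\<exists>p. pre_digraph.apath G u p v \<and> length p \<le> n"
  then obtain p where p: "pre_digraph.apath G u p v" "length p \<le> n"
    by blast
  have "graph_distance G u v \<le> enat (length p)"
    unfolding graph_distance_def using p(1) by (intro INF_lower) simp
  also have "\<dots> \<le> enat n"
    using p(2) by simp
  finally show "graph_distance G u v \<le> enat n" .
qed

lemma graph_diameter_le_iff:
  "graph_diameter G \<le> enat n \<longleftrightarrow>
    (\<forall>u \<in> verts G. \<forall>v \<in> verts G. \<exists>p. pre_digraph.apath G u p v \<and> length p \<le> n)"
  by (simp add: graph_diameter_def SUP_le_iff graph_distance_le_iff)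

lemma eq_enat_Suc_iff: "(d :: enat) = enat (Suc n) \<longleftrightarrow> d \<le> enat (Suc n) \<and> \<not> d \<le> enat n"
  by (cases d) auto

lemma zero_divisor_graph_simps [simp]:
  "pverts (zero_divisor_graph R) = nonzero_zero_divisors R"
  "(x, y) \<in> parcs (zero_divisor_graph R) \<longleftrightarrow>
    x \<in> nonzero_zero_divisors R \<and> y \<in> nonzero_zero_divisors R \<and> x \<noteq> y \<and> x \<otimes>\<^bsub>R\<^esub> y = \<zero>\<^bsub>R\<^esub>"
  by (simp_all add: zero_divisor_graph_def)

context pair_loopfree_digraph
begin

lemma apath_length_le_0_iff: "(\<exists>p. apath u p v \<and> length p \<le> 0) \<longleftrightarrow> u = v \<and> u \<in> pverts G"
  by (auto simp: apath_Nil_iff)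

lemma apath_length_le_1_iff:
  "(\<exists>p. apath u p v \<and> length p \<le> 1) \<longleftrightarrow> u = v \<and> u \<in> pverts G \<or> (u, v) \<in> parcs G"
proof
  assume "\<exists>p. apath u p v \<and> length p \<le> 1"
  then obtain p where p: "apath u p v" "length p \<le> 1"
    by blast
  then consider "p = []" | e where "p = [e]"
    by (cases p) auto
  then show "u = v \<and> u \<in> pverts G \<or> (u, v) \<in> parcs G"
    using p(1) by cases (auto simp: apath_simps)
next
  assume "u = v \<and> u \<in> pverts G \<or> (u, v) \<in> parcs G"
  then show "\<exists>p. apath u p v \<and> length p \<le> 1"
  proof
    assume "u = v \<and> u \<in> pverts G"
    then show ?thesis
      by (intro exI[of _ "[]"]) (auto simp: apath_simps)
  next
    assume "(u, v) \<in> parcs G"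
    then show ?thesis
      using pair_no_loops[of "(u, v)"] arc_snd_in_verts[of "(u, v)"]
      by (intro exI[of _ "[(u, v)]"]) (simp add: apath_simps)
  qed
qed

lemma apath_length_le_2_iff:
  "(\<exists>p. apath u p v \<and> length p \<le> 2) \<longleftrightarrow>
    u = v \<and> u \<in> pverts G \<or> (u, v) \<in> parcs G \<or>
    u \<noteq> v \<and> (\<exists>w. (u, w) \<in> parcs G \<and> (w, v) \<in> parcs G)"
proof
  assume "\<exists>p. apath u p v \<and> length p \<le> 2"
  then obtain p where p: "apath u p v" "length p \<le> 2"
    by blast
  then consider "length p \<le> 1" | e f where "p = [e, f]"
    by (cases p; cases "tl p"; cases "tl (tl p)") auto
  then show "u = v \<and> u \<in> pverts G \<or> (u, v) \<in> parcs G \<or>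
    u \<noteq> v \<and> (\<exists>w. (u, w) \<in> parcs G \<and> (w, v) \<in> parcs G)"
  proof cases
    case 1
    then show ?thesis
      using p(1) apath_length_le_1_iff by blast
  next
    case (2 e f)
    then show ?thesis
      using p(1) by (cases e; cases f) (auto simp: apath_simps)
  qed
next
  assume *: "u = v \<and> u \<in> pverts G \<or> (u, v) \<in> parcs G \<or>
    u \<noteq> v \<and> (\<exists>w. (u, w) \<in> parcs G \<and> (w, v) \<in> parcs G)"
  show "\<exists>p. apath u p v \<and> length p \<le> 2"
  proof (cases "u = v \<and> u \<in> pverts G \<or> (u, v) \<in> parcs G")
    case True
    then obtain p where "apath u p v" "length p \<le> 1"
      using apath_length_le_1_iff by blast
    then show ?thesis
      by (intro exI[of _ p]) simp
  next
    case False
    then obtain w where w: "u \<noteq> v" "(u, w) \<in> parcs G" "(w, v) \<in> parcs G"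
      using * by blast
    then show ?thesis
      using pair_no_loops[of "(u, w)"] pair_no_loops[of "(w, v)"] arc_snd_in_verts[of "(w, v)"]
      by (intro exI[of _ "[(u, w), (w, v)]"]) (simp add: apath_simps)
  qed
qed

lemma apath_length_3I:
  assumes "(u, a) \<in> parcs G" "(a, b) \<in> parcs G" "(b, v) \<in> parcs G"
    and "u \<noteq> b" "u \<noteq> v" "a \<noteq> v"
  shows "\<exists>p. apath u p v \<and> length p \<le> 3"
  using assms pair_no_loops[of "(u, a)"] pair_no_loops[of "(a, b)"] pair_no_loops[of "(b, v)"]
    arc_snd_in_verts[of "(b, v)"]
  by (intro exI[of _ "[(u, a), (a, b), (b, v)]"]) (simp add: apath_simps)

end

context cring
begin

lemma zero_divisor_graph_diameter_le_1_iff: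
  "graph_diameter (with_proj (zero_divisor_graph R)) \<le> enat 1 \<longleftrightarrow> pairwise_annihilating R"
proof -
  interpret G: pair_bidirected_digraph "zero_divisor_graph R"
    by (rule zero_divisor_graph_bidirected) (rule is_cring)
  show ?thesis
    unfolding graph_diameter_le_iff G.apath_length_le_1_iff pairwise_annihilating_def by auto
qed

text \<open>
  Because \<open>xy \<noteq> 0\<close>, a common annihilator of \<open>x\<close> and \<open>y\<close> differs from both of them.
\<close>

lemma common_neighbour_iff:
  assumes x: "x \<in> nonzero_zero_divisors R" and y: "y \<in> nonzero_zero_divisors R"
    and xy: "x \<otimes> y \<noteq> \<zero>"
  shows "(\<exists>w. (x, w) \<in> parcs (zero_divisor_graph R) \<and> (w, y) \<in> parcs (zero_divisor_graph R)) \<longleftrightarrow>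
    ann2 R x y \<noteq> {\<zero>}" (is "?path \<longleftrightarrow> _")
proof -
  have xy_carrier [simp]: "x \<in> carrier R" "y \<in> carrier R"
    using x y by (auto simp: nonzero_zero_divisors_def zero_divisors_closed)
  show ?thesis
  proof
    assume ?path
    then obtain w where w: "w \<in> nonzero_zero_divisors R" "x \<otimes> w = \<zero>" "w \<otimes> y = \<zero>"
      by auto
    then have "w \<in> carrier R" "w \<noteq> \<zero>"
      by (auto simp: nonzero_zero_divisors_def zero_divisors_closed)
    with w show "ann2 R x y \<noteq> {\<zero>}"
      using ann2_trivialD[of x y w] m_comm[of x w] by auto
  next
    assume "ann2 R x y \<noteq> {\<zero>}"
    then obtain w where w: "w \<in> carrier R" "w \<noteq> \<zero>" "w \<otimes> x = \<zero>" "w \<otimes> y = \<zero>"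
      using ann2_trivialI[of x y] by auto
    have xw: "x \<otimes> w = \<zero>" and "x \<noteq> \<zero>"
      using w x by (auto simp: m_comm nonzero_zero_divisors_def)
    then have "w \<in> nonzero_zero_divisors R"
      using w zero_divisorsI[of w x] by (simp add: nonzero_zero_divisors_def)
    moreover have "x \<noteq> w" "y \<noteq> w"
      using w xy xw by auto
    ultimately show ?path
      using w x y xw by (intro exI[of _ w]) auto
  qed
qed

lemma zero_divisor_graph_diameter_le_2_iff:
  "graph_diameter (with_proj (zero_divisor_graph R)) \<le> enat 2 \<longleftrightarrow> pairwise_linked R"
proof -
  interpret G: pair_bidirected_digraph "zero_divisor_graph R"
    by (rule zero_divisor_graph_bidirected) (rule is_cring)
  have "(\<exists>p. G.apath x p y \<and> length p \<le> 2) \<longleftrightarrow>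
      (x \<noteq> y \<longrightarrow> x \<otimes> y = \<zero> \<or> ann2 R x y \<noteq> {\<zero>})"
    if "x \<in> nonzero_zero_divisors R" "y \<in> nonzero_zero_divisors R" for x y
  proof (cases "x \<otimes> y = \<zero>")
    case True
    then show ?thesis
      unfolding G.apath_length_le_2_iff using that by auto
  next
    case False
    then show ?thesis
      unfolding G.apath_length_le_2_iff common_neighbour_iff[OF that False] using that by auto
  qed
  then show ?thesis
    unfolding graph_diameter_le_iff pairwise_linked_def by simp
qed

text \<open>
  Since \<open>ann(x, y) = 0\<close>, an annihilator \<open>a\<close> of \<open>x\<close> does not kill \<open>y\<close> and an annihilator \<open>b\<close> of \<open>y\<close>
  does not kill \<open>x\<close>, while \<open>ab \<in> ann(x, y)\<close> vanishes. Together with \<open>xy \<noteq> 0\<close> these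
  relations make \<open>x\<close>, \<open>a\<close>, \<open>b\<close>, \<open>y\<close> distinct, so they form a path.
\<close>

lemma zero_divisor_graph_diameter_le_3:
  "graph_diameter (with_proj (zero_divisor_graph R)) \<le> enat 3"
proof -
  interpret G: pair_bidirected_digraph "zero_divisor_graph R"
    by (rule zero_divisor_graph_bidirected) (rule is_cring)
  have "\<exists>p. G.apath x p y \<and> length p \<le> 3"
    if x: "x \<in> nonzero_zero_divisors R" and y: "y \<in> nonzero_zero_divisors R" for x y
  proof (cases "\<exists>p. G.apath x p y \<and> length p \<le> 2")
    case True
    then obtain p where "G.apath x p y" "length p \<le> 2"
      by blast
    then show ?thesis
      by (intro exI[of _ p]) simp
  next
    case False
    then have xy: "x \<noteq> y" "x \<otimes> y \<noteq> \<zero>" and ann: "ann2 R x y = {\<zero>}"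
      using x y common_neighbour_iff[OF x y] unfolding G.apath_length_le_2_iff by auto
    obtain a where a: "x \<in> carrier R" "a \<in> carrier R" "a \<noteq> \<zero>" "a \<otimes> x = \<zero>"
      using x by (auto simp: nonzero_zero_divisors_def elim: zero_divisorsE)
    obtain b where b: "y \<in> carrier R" "b \<in> carrier R" "b \<noteq> \<zero>" "b \<otimes> y = \<zero>"
      using y by (auto simp: nonzero_zero_divisors_def elim: zero_divisorsE)
    have xa: "x \<otimes> a = \<zero>" and yb: "y \<otimes> b = \<zero>"
      using a b by (simp_all add: m_comm)
    have "(a \<otimes> b) \<otimes> x = b \<otimes> (a \<otimes> x)" "(a \<otimes> b) \<otimes> y = a \<otimes> (b \<otimes> y)"
      using a(1,2) b(1,2) by algebra+
    then have "a \<otimes> b \<in> carrier R" "(a \<otimes> b) \<otimes> x = \<zero>" "(a \<otimes> b) \<otimes> y = \<zero>"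
      using a b by simp_all
    then have ab: "a \<otimes> b = \<zero>"
      by (rule ann2_trivialD[OF ann])
    have "x \<noteq> \<zero>" "y \<noteq> \<zero>"
      using x y by (auto simp: nonzero_zero_divisors_def)
    then have Z: "a \<in> nonzero_zero_divisors R" "b \<in> nonzero_zero_divisors R"
      using a b xa yb zero_divisorsI[of a x] zero_divisorsI[of b y]
      by (simp_all add: nonzero_zero_divisors_def)
    have ne: "a \<otimes> y \<noteq> \<zero>" "b \<otimes> x \<noteq> \<zero>"
      using ann a b by (auto dest: ann2_trivialD)
    have ba: "b \<otimes> a = \<zero>"
      using ab a b by (simp add: m_comm)
    have "a \<noteq> b"
      using ne(1) b(4) by blast
    moreover have "x \<noteq> a"
      using ba ne(2) by blast
    moreover have "b \<noteq> y"
      using ab ne(1) by blast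
    moreover have "x \<noteq> b" "a \<noteq> y"
      using xy(2) a(4) b(4) xa by auto
    ultimately show ?thesis
      using x y Z xa ab b(4) xy(1) by (intro G.apath_length_3I[of x a b y]) auto
  qed
  then show ?thesis
    unfolding graph_diameter_le_iff by simp
qed

end

section \<open>The diameter of the zero-divisor graph\<close>

theorem theorem1p12:
  fixes R :: "('a, 'm) ring_scheme"
  assumes "cring R"
    and "\<one>\<^bsub>R\<^esub> \<noteq> \<zero>\<^bsub>R\<^esub>"
    and "infinite (nonzero_zero_divisors R) \<or> card (nonzero_zero_divisors R) > 1"
  shows
    "(graph_diameter (with_proj (zero_divisor_graph R)) = 1 \<longleftrightarrow>
        R \<simeq> Z2_squared \<or> zero_divisors_square_zero R)
     \<and>
     (graph_diameter (with_proj (zero_divisor_graph R)) = 2 \<longleftrightarrow>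
        (subring_of_two_domains R \<and> \<not> R \<simeq> Z2_squared) \<or>
        (ideal (zero_divisors R) R \<and> \<not> zero_divisors_square_zero R \<and>
         (\<forall>x \<in> zero_divisors R. \<forall>y \<in> zero_divisors R. x \<noteq> y \<longrightarrow> ann2 R x y \<noteq> {\<zero>\<^bsub>R\<^esub>})))
     \<and>
     (graph_diameter (with_proj (zero_divisor_graph R)) = 3 \<longleftrightarrow>
        (boolean_ring R \<and> \<not> R \<simeq> Z2_squared) \<or>
        (\<not> ideal (zero_divisors R) R \<and> \<not> boolean_ring R \<and> \<not> subring_of_two_domains R) \<or>
        (ideal (zero_divisors R) R \<and>
         (\<exists>x \<in> zero_divisors R. \<exists>y \<in> zero_divisors R. ann2 R x y = {\<zero>\<^bsub>R\<^esub>})))"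
proof -
  interpret R: cring R by (rule assms(1))
  let ?d = "graph_diameter (with_proj (zero_divisor_graph R))"
  interpret G: pair_bidirected_digraph "zero_divisor_graph R"
    by (rule zero_divisor_graph_bidirected) (rule assms(1))
  obtain u v where uv: "u \<in> nonzero_zero_divisors R" "v \<in> nonzero_zero_divisors R" "u \<noteq> v"
  proof -
    have "\<not> (\<exists>u. nonzero_zero_divisors R \<subseteq> {u})"
      using assms(3) by (auto simp: subset_singleton_iff)
    then show thesis
      using that by blast
  qed
  have "\<not> ?d \<le> enat 0"
    unfolding graph_diameter_le_iff G.apath_length_le_0_iff using uv by auto
  then have d1: "?d = 1 \<longleftrightarrow> pairwise_annihilating R"
    using eq_enat_Suc_iff[of ?d 0] R.zero_divisor_graph_diameter_le_1_iff by (simp add: one_enat_def)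
  have d2: "?d = 2 \<longleftrightarrow> pairwise_linked R \<and> \<not> pairwise_annihilating R"
    using eq_enat_Suc_iff[of ?d 1]
      R.zero_divisor_graph_diameter_le_1_iff R.zero_divisor_graph_diameter_le_2_iff
    by (simp add: numeral_eq_enat numeral_2_eq_2)
  \<comment> \<open>Diameter 3 means "not at most 2", as 3 is a bound in any case.\<close>
  have d3: "?d = 3 \<longleftrightarrow> \<not> pairwise_linked R"
    using eq_enat_Suc_iff[of ?d 2]
      R.zero_divisor_graph_diameter_le_2_iff R.zero_divisor_graph_diameter_le_3
    by (simp add: numeral_eq_enat numeral_3_eq_3 numeral_2_eq_2)
  \<comment> \<open>A zero-divisor always has a nonzero annihilator in common with itself, so \<open>P\<close> agrees with its
    restriction to distinct pairs.\<close>
  define P where "P \<longleftrightarrow> (\<forall>x \<in> zero_divisors R. \<forall>y \<in> zero_divisors R. ann2 R x y \<noteq> {\<zero>\<^bsub>R\<^esub>})"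
  have P_distinct: "(\<forall>x \<in> zero_divisors R. \<forall>y \<in> zero_divisors R.
      x \<noteq> y \<longrightarrow> ann2 R x y \<noteq> {\<zero>\<^bsub>R\<^esub>}) \<longleftrightarrow> P"
    unfolding P_def using R.ann2_self_nontrivial by metis
  have not_P: "(\<exists>x \<in> zero_divisors R. \<exists>y \<in> zero_divisors R. ann2 R x y = {\<zero>\<^bsub>R\<^esub>}) \<longleftrightarrow> \<not> P"
    unfolding P_def by simp
  have link_ideal: "ideal (zero_divisors R) R \<longrightarrow> (pairwise_linked R \<longleftrightarrow> P)"
    unfolding P_def using R.pairwise_linked_iff_if_ideal by (rule impI)
  have link_not_ideal: "\<not> ideal (zero_divisors R) R \<longrightarrow>
      (pairwise_linked R \<longleftrightarrow> subring_of_two_domains R)"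
    using R.pairwise_linked_iff_if_not_ideal[OF assms(2)] by (rule impI)
  have sub: "\<not> ideal (zero_divisors R) R \<and> \<not> zero_divisors_square_zero R \<and>
      (boolean_ring R \<longrightarrow> pairwise_annihilating R)" if two: "subring_of_two_domains R"
  proof -
    obtain I J where IJ: "primeideal I R" "primeideal J R" "I \<inter> J = {\<zero>\<^bsub>R\<^esub>}"
      using two subring_of_two_domains_iff_primeideals[OF assms(1)] by blast
    have "u \<in> carrier R" "u \<noteq> \<zero>\<^bsub>R\<^esub>"
      using uv(1) by (simp_all add: R.nonzero_zero_divisors_iff R.zero_divisors_closed)
    then have "u \<otimes>\<^bsub>R\<^esub> u \<noteq> \<zero>\<^bsub>R\<^esub>"
      using R.reduced_if_primeideals[OF IJ] by metis
    then have "\<not> zero_divisors_square_zero R"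
      using uv(1) by (auto simp: zero_divisors_square_zero_def R.nonzero_zero_divisors_iff)
    then show ?thesis
      using R.not_ideal_zero_divisors_if_primeideals[OF IJ] uv(1)
        R.pairwise_annihilating_if_boolean_primeideals[OF _ IJ] by blast
  qed
  have bool: "\<not> ideal (zero_divisors R) R" if bool: "boolean_ring R"
  proof
    assume "ideal (zero_divisors R) R"
    then interpret Z: ideal "zero_divisors R" R .
    have u: "u \<in> zero_divisors R" "u \<noteq> \<zero>\<^bsub>R\<^esub>" "u \<in> carrier R"
      using uv(1) by (auto simp: R.nonzero_zero_divisors_iff R.zero_divisors_closed)
    have "u \<otimes>\<^bsub>R\<^esub> (\<one>\<^bsub>R\<^esub> \<ominus>\<^bsub>R\<^esub> u) = u \<ominus>\<^bsub>R\<^esub> u \<otimes>\<^bsub>R\<^esub> u"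
      using u(3) by algebra
    also have "\<dots> = \<zero>\<^bsub>R\<^esub>"
      using bool u(3) by (simp add: boolean_ring_def a_minus_def R.r_neg)
    finally have "\<one>\<^bsub>R\<^esub> \<ominus>\<^bsub>R\<^esub> u \<in> zero_divisors R"
      using u by (intro R.zero_divisorsI[of _ u]) auto
    then have "u \<oplus>\<^bsub>R\<^esub> (\<one>\<^bsub>R\<^esub> \<ominus>\<^bsub>R\<^esub> u) \<in> zero_divisors R"
      using u(1) by (intro Z.a_closed)
    moreover have "u \<oplus>\<^bsub>R\<^esub> (\<one>\<^bsub>R\<^esub> \<ominus>\<^bsub>R\<^esub> u) = \<one>\<^bsub>R\<^esub>"
      using u(3) by algebra
    ultimately show False
      using R.one_notin_zero_divisors by simp
  qed
  have linked: "pairwise_annihilating R \<Longrightarrow> pairwise_linked R"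
    by (auto simp: pairwise_annihilating_def pairwise_linked_def)
  show ?thesis
    unfolding d1 d2 d3 P_distinct not_P
    using R.pairwise_annihilating_iff R.not_ideal_zero_divisors_if_iso_Z2_squared
      link_ideal link_not_ideal sub bool linked
    by argo
qed

end
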